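(* Let $G$ be a graph with vertex set $[n]$, let $B^0,B^1,\dots,B^k$ be real symmetric $n\times n$ matrices and $b_1,\dots,b_k\in\mathbb{R}$. Let (SDP) be the problem $$\text{minimize } \langle B^0,X\rangle \ \text{ such that } \ \mathrm{tr}(X)=1,\ \langle B^\ell,X\rangle=b_\ell\ (\ell=1,\dots,k),\ X\succeq 0,$$ over real symmetric $n\times n$ matrices $X$, and let (SDP') be the problem with the same objective and the same linear constraints but with the condition $X\succeq0$ replaced by $X\in\mathcal{P}(G)$. Let $\alpha$ be the value of (SDP) and $\alpha'$ the value of (SDP'). If $\frac1n I_n$ is a feasible point of (SDP), and (SDP) is $G$-sparse, then $$\alpha' \le \alpha \le \frac{1}{1+n\varepsilon(G)}\alpha' + \frac{\varepsilon(G)}{1+n\varepsilon(G)}\mathrm{tr}(B^0).$$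
   Context: (SDP) is $G$-sparse if for each $\ell\in\{0,1,\dots,k\}$, $B^\ell_{ij}=0$ for all $i\neq j$ with $\{i,j\}\notin E(G)$. $\langle B,X\rangle=\sum_{i,j}B_{ij}X_{ij}$; when $B$ is supported on the diagonal and the edges of $G$ this depends only on the diagonal and edge entries of $X$, so it is well defined for $X\in\mathrm{Sym}(G)$. Graphs are finite, simple, undirected, with at least one vertex. For a graph $G$ with vertex set $[n]$, $\mathrm{Sym}(G)=\mathbb{R}^{V(G)+E(G)}$ is the space of partially specified symmetric $n\times n$ real matrices: $A\in\mathrm{Sym}(G)$ specifies the diagonal entries $A_{ii}$ and the entries $A_{ij}=A_{ji}$ for $\{i,j\}\in E(G)$, the others being unspecified. $\mathrm{tr}(A)=\sum_i A_{ii}$, and $I_n$ also denotes the image of the identity matrix in $\mathrm{Sym}(G)$. $\Sigma(G)$ is the set of $A\in\mathrm{Sym}(G)$ for which there is a real symmetric positive semidefinite (PSD) $n\times n$ matrix agreeing with $A$ on all specified entries. $\mathcal{P}(G)$ is the set of $A\in \mathrm{Sym}(G)$ such that for every maximal clique $K$ of $G$ the (fully specified) principal submatrix of $A$ indexed by $K$ is PSD. $\bar{\mathcal{P}}(G)=\{A\in\mathcal{P}(G):\mathrm{tr}(A)=1\}$. The conical distance $\varepsilon(G)$ is the smallest real $\varepsilon\ge 0$ such that $M+\varepsilon I_n\in\Sigma(G)$ for all $M\in\bar{\mathcal{P}}(G)$. *)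

theory Defs
  imports "HOL-Analysis.Analysis" "HOL-Library.Ramsey"
begin

text \<open>
  The vertex set of a graph is the whole finite type \<open>'n\<close>, so the number of vertices is
  \<open>CARD('n)\<close>, and a graph is given by its set of edges \<open>E\<close>. The predicate \<open>clique\<close> and the
  operator \<open>nsets\<close> come from \<open>HOL-Library.Ramsey\<close>.
\<close>

definition simple_graph :: "'n::finite set set \<Rightarrow> bool" where
  "simple_graph E \<longleftrightarrow> E \<subseteq> nsets UNIV 2"

definition maximal_clique :: "'n::finite set set \<Rightarrow> 'n set \<Rightarrow> bool" where
  "maximal_clique E K \<longleftrightarrow> clique K E \<and> (\<forall>K'. clique K' E \<and> K \<subseteq> K' \<longrightarrow> K' = K)"

definition specified :: "'n::finite set set \<Rightarrow> 'n \<Rightarrow> 'n \<Rightarrow> bool" where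
  "specified E i j \<longleftrightarrow> i = j \<or> {i, j} \<in> E"

definition sym_matrix :: "real^'n^'n \<Rightarrow> bool" where
  "sym_matrix A \<longleftrightarrow> transpose A = A"

text \<open>
  Partially specified symmetric matrices. An unspecified entry is stored as \<open>0\<close>; this is a
  placeholder only, which makes this set a linear subspace of the matrices, with coordinates
  indexed by the vertices and the edges. In particular, \<open>mat 1\<close> lies in it and is the image of
  the identity matrix, \<open>+\<close> and \<open>trace\<close> are those of partial matrices, and for partial \<open>X\<close>
  the inner product \<open>B \<bullet> X\<close> is the sum of \<open>B\<^sub>i\<^sub>j * X\<^sub>i\<^sub>j\<close> over the specified pairs \<open>(i, j)\<close>.
\<close>

definition Sym :: "'n::finite set set \<Rightarrow> (real^'n^'n) set" where
  "Sym E = {A. sym_matrix A \<and> (\<forall>i j. \<not> specified E i j \<longrightarrow> A $ i $ j = 0)}"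

text \<open>The principal submatrix of \<open>A\<close> indexed by \<open>K\<close> is symmetric positive semidefinite.\<close>

definition psd_on :: "'n::finite set \<Rightarrow> real^'n^'n \<Rightarrow> bool" where
  "psd_on K A \<longleftrightarrow> (\<forall>i\<in>K. \<forall>j\<in>K. A $ i $ j = A $ j $ i)
     \<and> (\<forall>x :: 'n \<Rightarrow> real. 0 \<le> (\<Sum>i\<in>K. \<Sum>j\<in>K. x i * A $ i $ j * x j))"

abbreviation psd :: "real^'n::finite^'n \<Rightarrow> bool" where
  "psd A \<equiv> psd_on UNIV A"

definition psd_completable :: "'n::finite set set \<Rightarrow> (real^'n^'n) set" where
  "psd_completable E =
     {A \<in> Sym E. \<exists>X. psd X \<and> (\<forall>i j. specified E i j \<longrightarrow> X $ i $ j = A $ i $ j)}"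

definition locally_psd :: "'n::finite set set \<Rightarrow> (real^'n^'n) set" where
  "locally_psd E = {A \<in> Sym E. \<forall>K. maximal_clique E K \<longrightarrow> psd_on K A}"

definition locally_psd_tr1 :: "'n::finite set set \<Rightarrow> (real^'n^'n) set" where
  "locally_psd_tr1 E = {A \<in> locally_psd E. trace A = 1}"

definition conical_distance :: "'n::finite set set \<Rightarrow> real" where
  "conical_distance E = (LEAST \<epsilon>. 0 \<le> \<epsilon> \<and>
     (\<forall>M \<in> locally_psd_tr1 E. M + \<epsilon> *\<^sub>R mat 1 \<in> psd_completable E))"

text \<open>
  The data of the problem are \<open>B 0, \<dots>, B k\<close> and \<open>b 1, \<dots>, b k\<close>; other values of \<open>B\<close> and \<open>b\<close>
  are never used. The inner product of \<open>real^'n^'n\<close> is the entrywise one.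
\<close>

definition sparse_data :: "'n::finite set set \<Rightarrow> nat \<Rightarrow> (nat \<Rightarrow> real^'n^'n) \<Rightarrow> bool" where
  "sparse_data E k B \<longleftrightarrow>
     (\<forall>l \<in> {0..k}. \<forall>i j. i \<noteq> j \<and> {i, j} \<notin> E \<longrightarrow> B l $ i $ j = 0)"

definition sdp_linear :: "nat \<Rightarrow> (nat \<Rightarrow> real^'n::finite^'n) \<Rightarrow> (nat \<Rightarrow> real) \<Rightarrow> (real^'n^'n) set" where
  "sdp_linear k B b = {X. trace X = 1 \<and> (\<forall>l \<in> {1..k}. B l \<bullet> X = b l)}"

definition sdp_feasible :: "nat \<Rightarrow> (nat \<Rightarrow> real^'n::finite^'n) \<Rightarrow> (nat \<Rightarrow> real) \<Rightarrow> (real^'n^'n) set" where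
  "sdp_feasible k B b = {X \<in> sdp_linear k B b. psd X}"

definition sdp'_feasible ::
  "'n::finite set set \<Rightarrow> nat \<Rightarrow> (nat \<Rightarrow> real^'n^'n) \<Rightarrow> (nat \<Rightarrow> real) \<Rightarrow> (real^'n^'n) set" where
  "sdp'_feasible E k B b = {X \<in> sdp_linear k B b. X \<in> locally_psd E}"

text \<open>Values are extended reals: \<open>\<infinity>\<close> for an infeasible problem, \<open>-\<infinity>\<close> for an unbounded one.\<close>

definition sdp_value :: "nat \<Rightarrow> (nat \<Rightarrow> real^'n::finite^'n) \<Rightarrow> (nat \<Rightarrow> real) \<Rightarrow> ereal" where
  "sdp_value k B b = (INF X \<in> sdp_feasible k B b. ereal (B 0 \<bullet> X))"

definition sdp'_value ::
  "'n::finite set set \<Rightarrow> nat \<Rightarrow> (nat \<Rightarrow> real^'n^'n) \<Rightarrow> (nat \<Rightarrow> real) \<Rightarrow> ereal" where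
  "sdp'_value E k B b = (INF X \<in> sdp'_feasible E k B b. ereal (B 0 \<bullet> X))"

end

theory Submission
  imports Defs
begin

text \<open>
  The bounds come from moving feasible points between the two problems. Restricting a feasible
  \<open>X\<close> of (SDP) to the specified entries gives a feasible point of (SDP') with the same objective
  value. Conversely, if \<open>Y\<close> is feasible for (SDP') and \<open>X\<close> is a PSD completion of
  \<open>Y + \<epsilon> I\<close>, then \<open>X / (1 + n \<epsilon>)\<close> is feasible for (SDP): feasibility of \<open>I / n\<close> means
  \<open>tr B\<^sub>l = n b\<^sub>l\<close>, so the linear constraints survive the averaging of \<open>Y\<close> with \<open>I / n\<close>.
  The conical distance is attained because \<open>\<epsilon> = n\<close> is admissible by diagonal dominance and,
  for each \<open>M\<close>, the set of admissible \<open>\<epsilon> \<le> n\<close> is a projection of a compact set of pairs \<open>(\<epsilon>, X)\<close>.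
\<close>

section \<open>Principal submatrices and entry bounds\<close>

lemma psd_on_subset:
  assumes "psd_on K A" "L \<subseteq> K"
  shows "psd_on L A"
  unfolding psd_on_def
proof (intro conjI allI)
  show "\<forall>i\<in>L. \<forall>j\<in>L. A $ i $ j = A $ j $ i"
    using assms(1)[unfolded psd_on_def, THEN conjunct1] assms(2) by blast
  fix x :: "'a \<Rightarrow> real"
  \<comment> \<open>Extending a test vector by zero turns a quadratic form over \<open>L\<close>
    into one over \<open>K\<close>.\<close>
  let ?x = "\<lambda>i. if i \<in> L then x i else 0"
  have "(\<Sum>i\<in>L. \<Sum>j\<in>L. x i * A $ i $ j * x j) = (\<Sum>i\<in>K. \<Sum>j\<in>K. ?x i * A $ i $ j * ?x j)"
    using assms(2) by (intro sum.mono_neutral_cong_left) auto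
  also have "\<dots> \<ge> 0"
    using assms(1)[unfolded psd_on_def, THEN conjunct2, THEN spec[of _ ?x]] by simp
  finally show "0 \<le> (\<Sum>i\<in>L. \<Sum>j\<in>L. x i * A $ i $ j * x j)" .
qed

text \<open>The test vectors e_i + e_j and e_i - e_j on the submatrix indexed by
  \<open>{i, j}\<close> give the two signs. With \<open>i = j\<close> the bound says that the
  diagonal entry is nonnegative, and it is used in this way below.\<close>

lemma psd_on_entry_bound:
  assumes "psd_on K A" "i \<in> K" "j \<in> K"
  shows "\<bar>A $ i $ j\<bar> \<le> (A $ i $ i + A $ j $ j) / 2"
proof (cases "i = j")
  case True
  have "psd_on {i} A" by (rule psd_on_subset[OF assms(1)]) (use assms in simp)
  from this[unfolded psd_on_def, THEN conjunct2, THEN spec[of _ "\<lambda>_. 1"]] True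
  show ?thesis by simp
next
  case False
  have p: "psd_on {i, j} A" by (rule psd_on_subset[OF assms(1)]) (use assms in simp)
  note q = p[unfolded psd_on_def, THEN conjunct2, rule_format]
  have "A $ i $ j = A $ j $ i" using p[unfolded psd_on_def, THEN conjunct1] by blast
  moreover have "0 \<le> A $ i $ i + A $ i $ j + (A $ j $ i + A $ j $ j)"
    using q[of "\<lambda>_. 1"] False by simp
  moreover have "0 \<le> A $ i $ i - A $ i $ j - (A $ j $ i - A $ j $ j)"
    using q[of "\<lambda>k. if k = i then 1 else - 1"] False by simp
  ultimately show ?thesis unfolding abs_le_iff by (intro conjI; simp)
qed

lemma entry_le_trace:
  fixes A :: "real^'n::finite^'n"
  assumes diag: "\<And>i. 0 \<le> A $ i $ i"
    and "\<bar>A $ i $ j\<bar> \<le> (A $ i $ i + A $ j $ j) / 2"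
  shows "\<bar>A $ i $ j\<bar> \<le> trace A"
proof -
  have "A $ k $ k \<le> trace A" for k
    unfolding trace_def by (rule member_le_sum) (use diag in auto)
  from add_mono[OF this[of i] this[of j]] have "(A $ i $ i + A $ j $ j) / 2 \<le> trace A"
    by simp
  with assms(2) show ?thesis by (rule order_trans)
qed

lemma psd_entry_le_trace:
  assumes "psd A"
  shows "\<bar>A $ i $ j\<bar> \<le> trace A"
proof (rule entry_le_trace)
  show "0 \<le> A $ k $ k" for k using psd_on_entry_bound[OF assms, of k k] by simp
qed (use psd_on_entry_bound[OF assms] in simp)

lemma clique_subset_maximal_clique:
  fixes E :: "'n::finite set set"
  assumes "clique L E"
  obtains K where "maximal_clique E K" "L \<subseteq> K"
proof -
  obtain K where "K \<in> {K. clique K E}" "L \<subseteq> K"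
      and "\<forall>K'\<in>{K. clique K E}. K \<subseteq> K' \<longrightarrow> K = K'"
    using finite_has_maximal2[of "{K. clique K E}" L] assms by auto
  then have "maximal_clique E K" by (auto simp: maximal_clique_def)
  with \<open>L \<subseteq> K\<close> show thesis by (rule that[rotated])
qed

text \<open>A vertex or an edge is a clique, so it lies in a maximal one, whose submatrix is
  PSD.\<close>

lemma locally_psd_entry_bound:
  assumes "M \<in> locally_psd E" "specified E i j"
  shows "\<bar>M $ i $ j\<bar> \<le> (M $ i $ i + M $ j $ j) / 2"
proof -
  have "clique {i, j} E"
    using assms(2) by (auto simp: clique_def specified_def insert_commute)
  then obtain K where "maximal_clique E K" "{i, j} \<subseteq> K"
    by (rule clique_subset_maximal_clique)
  then have "psd_on K M" "i \<in> K" "j \<in> K"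
    using assms(1) by (auto simp: locally_psd_def)
  then show ?thesis by (rule psd_on_entry_bound)
qed

text \<open>At the placeholder zeros the bound is trivial, so all entries of the stored matrix are
  controlled, as \<open>psd_add_scaleR_mat_one\<close> requires.\<close>

lemma locally_psd_entry_le_trace:
  assumes "M \<in> locally_psd E"
  shows "\<bar>M $ i $ j\<bar> \<le> trace M"
proof -
  have diag: "0 \<le> M $ k $ k" for k
    using locally_psd_entry_bound[OF assms, of k k] by (simp add: specified_def)
  show ?thesis
  proof (rule entry_le_trace[OF diag])
    show "\<bar>M $ i $ j\<bar> \<le> (M $ i $ i + M $ j $ j) / 2"
    proof (cases "specified E i j")
      case False
      then have "M $ i $ j = 0" using assms by (auto simp: locally_psd_def Sym_def)
      with diag[of i] diag[of j] show ?thesis by simp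
    qed (use locally_psd_entry_bound[OF assms] in blast)
  qed
qed

section \<open>Shifts by the identity and diagonal dominance\<close>

lemma mat_one_in_Sym: "mat 1 \<in> Sym E"
  by (auto simp: Sym_def sym_matrix_def specified_def transpose_mat) (simp add: mat_def)

lemma Sym_add_scaleR_mat_one: "M \<in> Sym E \<Longrightarrow> M + c *\<^sub>R mat 1 \<in> Sym E"
  using mat_one_in_Sym[of E]
  by (auto simp: Sym_def sym_matrix_def transpose_def vec_eq_iff)

lemma trace_scaleR: "trace (c *\<^sub>R A) = c * trace (A :: real^'n^'n)"
  by (simp add: trace_def sum_distrib_left)

lemma trace_mat_one: "trace (mat 1 :: real^'n^'n) = real CARD('n)"
  by (simp add: trace_def mat_def)

lemma inner_mat_one: "B \<bullet> (mat 1 :: real^'n^'n) = trace B"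
  by (simp add: inner_vec_def trace_def mat_def if_distrib cong: if_cong)

text \<open>Each term of the quadratic form of \<open>M\<close> is at least
  \<open>- ((x i)\<^sup>2 + (x j)\<^sup>2) / 2\<close>. Over all pairs these bounds add up to -n
  times the squared norm of \<open>x\<close>, which is exactly what the shift compensates.\<close>

lemma psd_add_scaleR_mat_one:
  fixes M :: "real^'n::finite^'n"
  assumes sym: "sym_matrix M" and le1: "\<And>i j. \<bar>M $ i $ j\<bar> \<le> 1"
  shows "psd (M + real CARD('n) *\<^sub>R mat 1)"
  unfolding psd_on_def
proof (intro conjI allI)
  have "M $ i $ j = M $ j $ i" for i j
    using sym by (auto simp: sym_matrix_def transpose_def vec_eq_iff)
  then show "\<forall>i\<in>UNIV. \<forall>j\<in>UNIV. (M + real CARD('n) *\<^sub>R mat 1) $ i $ j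
      = (M + real CARD('n) *\<^sub>R mat 1) $ j $ i"
    by (auto simp: mat_def)
  fix x :: "'n \<Rightarrow> real"
  have "- ((x i)\<^sup>2 + (x j)\<^sup>2) / 2 \<le> x i * M $ i $ j * x j" for i j
  proof -
    have "\<bar>x i * M $ i $ j * x j\<bar> = \<bar>M $ i $ j\<bar> * \<bar>x i * x j\<bar>" by (simp add: abs_mult)
    also have "\<dots> \<le> 1 * \<bar>x i * x j\<bar>" by (rule mult_right_mono[OF le1]) simp
    also have "\<dots> \<le> ((x i)\<^sup>2 + (x j)\<^sup>2) / 2"
      using sum_squares_bound[of "\<bar>x i\<bar>" "\<bar>x j\<bar>"] by (simp add: abs_mult)
    finally show ?thesis by (simp add: abs_le_iff)
  qed
  then have "(\<Sum>i\<in>UNIV. \<Sum>j\<in>UNIV. - ((x i)\<^sup>2 + (x j)\<^sup>2) / 2)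
      \<le> (\<Sum>i\<in>UNIV. \<Sum>j\<in>UNIV. x i * M $ i $ j * x j)"
    by (intro sum_mono)
  moreover have "(\<Sum>i\<in>UNIV. \<Sum>j\<in>UNIV. - ((x i)\<^sup>2 + (x j)\<^sup>2) / 2)
      = - real CARD('n) * (\<Sum>i\<in>UNIV. (x i)\<^sup>2)"
  proof -
    have "(\<Sum>i\<in>UNIV. \<Sum>j\<in>UNIV. - ((x i)\<^sup>2 + (x j)\<^sup>2) / 2)
      = - (\<Sum>i\<in>UNIV. \<Sum>j\<in>UNIV. (x i)\<^sup>2 / 2 + (x j)\<^sup>2 / 2)"
      by (simp add: sum_negf[symmetric] add_divide_distrib diff_divide_distrib)
    then show ?thesis
      by (simp add: sum.distrib sum_distrib_left[symmetric] sum_divide_distrib[symmetric])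
  qed
  moreover have "(\<Sum>i\<in>UNIV. \<Sum>j\<in>UNIV. x i * (M + real CARD('n) *\<^sub>R mat 1) $ i $ j * x j)
      = (\<Sum>i\<in>UNIV. \<Sum>j\<in>UNIV. x i * M $ i $ j * x j) + real CARD('n) * (\<Sum>i\<in>UNIV. (x i)\<^sup>2)"
  proof -
    have "(\<Sum>j\<in>UNIV. x i * (M + real CARD('n) *\<^sub>R mat 1) $ i $ j * x j)
      = (\<Sum>j\<in>UNIV. x i * M $ i $ j * x j) + real CARD('n) * (x i)\<^sup>2" for i
    proof -
      have "x i * (M + real CARD('n) *\<^sub>R mat 1) $ i $ j * x j
        = x i * M $ i $ j * x j + (if i = j then real CARD('n) * (x i)\<^sup>2 else 0)" for j
        by (simp add: mat_def power2_eq_square algebra_simps)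
      then show ?thesis by (simp add: sum.distrib)
    qed
    then show ?thesis by (simp add: sum.distrib sum_distrib_left)
  qed
  ultimately show "0 \<le> (\<Sum>i\<in>UNIV. \<Sum>j\<in>UNIV. x i * (M + real CARD('n) *\<^sub>R mat 1) $ i $ j * x j)"
    by simp
qed

section \<open>Compactness and attainment of the conical distance\<close>

lemma norm_matrix_le:
  fixes X :: "real^'n::finite^'n"
  assumes "\<And>i j. \<bar>X $ i $ j\<bar> \<le> c"
  shows "norm X \<le> real CARD('n) * (real CARD('n) * c)"
proof -
  have "norm (X $ i) \<le> real CARD('n) * c" for i
    by (rule order_trans[OF norm_le_l1_cart])
      (use assms sum_bounded_above[of UNIV "\<lambda>j. \<bar>X $ i $ j\<bar>" c] in simp)
  moreover have "norm X \<le> (\<Sum>i\<in>UNIV. norm (X $ i))"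
    unfolding norm_vec_def by (rule L2_set_le_sum) simp
  ultimately show ?thesis
    using sum_bounded_above[of UNIV "\<lambda>i. norm (X $ i)" "real CARD('n) * c"] by simp
qed

text \<open>Pairing the scalar with the completion makes the admissible scalars a continuous image
  of a compact set. Boundedness holds because the diagonal is specified: it fixes the trace of the
  completion, and the trace bounds every entry of a PSD matrix.\<close>

lemma compact_completions:
  fixes M :: "real^'n::finite^'n"
  shows "compact {p :: real \<times> (real^'n^'n). 0 \<le> fst p \<and> fst p \<le> c \<and> psd (snd p) \<and>
    (\<forall>i j. specified E i j \<longrightarrow> snd p $ i $ j = (M + fst p *\<^sub>R mat 1) $ i $ j)}"
    (is "compact ?C")
proof -
  \<comment> \<open>The guard \<open>specified E i j\<close> does not depend on the pair, so each
    guarded equation is a closed condition.\<close>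
  have "closed ?C"
    unfolding psd_on_def Ball_def
    by (intro closed_Collect_conj closed_Collect_all closed_Collect_imp open_Collect_const
        closed_Collect_le closed_Collect_eq) (intro continuous_intros)+
  moreover have "bounded ?C"
  proof (rule bounded_subset)
    define d where "d = real CARD('n) * (real CARD('n) * (trace M + c * real CARD('n)))"
    show "bounded ({0..c} \<times> cball (0 :: real^'n^'n) d)"
      by (intro bounded_Times bounded_cball bounded_closed_interval)
    show "?C \<subseteq> {0..c} \<times> cball 0 d"
    proof clarsimp
      fix e X
      assume e: "0 \<le> e" "e \<le> c" and X: "psd X"
        and ag: "\<forall>i j. specified E i j \<longrightarrow> X $ i $ j = M $ i $ j + e * mat 1 $ i $ j"
      have "trace X = trace M + e * real CARD('n)"
        using ag by (simp add: trace_def specified_def mat_def sum.distrib)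
      also have "\<dots> \<le> trace M + c * real CARD('n)" using e by (simp add: mult_right_mono)
      finally show "norm X \<le> d"
        unfolding d_def by (intro norm_matrix_le order_trans[OF psd_entry_le_trace[OF X]])
    qed
  qed
  ultimately show ?thesis by (simp add: compact_eq_bounded_closed)
qed

text \<open>A \<open>LEAST\<close> over the reals says nothing until a minimum is known to exist;
  this makes the definition usable.\<close>

lemma conical_distance_attained:
  fixes E :: "'n::finite set set"
  shows "0 \<le> conical_distance E \<and>
    (\<forall>M \<in> locally_psd_tr1 E. M + conical_distance E *\<^sub>R mat 1 \<in> psd_completable E)"
    (is "?P (conical_distance E)")
proof -
  let ?P = "\<lambda>\<epsilon>. 0 \<le> \<epsilon> \<and> (\<forall>M \<in> locally_psd_tr1 E. M + \<epsilon> *\<^sub>R mat 1 \<in> psd_completable E)"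
  let ?n = "real CARD('n)"
  let ?C = "\<lambda>M. {p :: real \<times> (real^'n^'n). 0 \<le> fst p \<and> fst p \<le> ?n \<and> psd (snd p) \<and>
    (\<forall>i j. specified E i j \<longrightarrow> snd p $ i $ j = (M + fst p *\<^sub>R mat 1) $ i $ j)}"
  \<comment> \<open>The cap \<open>?n\<close> gives compactness. It does not change the minimum,
    since \<open>?n\<close> is itself admissible.\<close>
  define S where "S = {0..?n} \<inter> (\<Inter>M\<in>locally_psd_tr1 E. fst ` ?C M)"
  have S: "e \<in> S \<longleftrightarrow> ?P e \<and> e \<le> ?n" for e
  proof -
    have "e \<in> fst ` ?C M \<longleftrightarrow> M + e *\<^sub>R mat 1 \<in> psd_completable E"
      if "0 \<le> e" "e \<le> ?n" "M \<in> locally_psd_tr1 E" for M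
    proof -
      have "M + e *\<^sub>R mat 1 \<in> Sym E"
        using that by (auto simp: locally_psd_tr1_def locally_psd_def intro: Sym_add_scaleR_mat_one)
      with that show ?thesis by (force simp: psd_completable_def image_iff)
    qed
    then show ?thesis by (auto simp: S_def)
  qed
  have "compact (fst ` ?C M)" for M
    by (intro compact_continuous_image compact_completions continuous_intros)
  then have "compact S"
    unfolding S_def by (intro compact_Int_closed closed_INT ballI compact_imp_closed) auto
  moreover have "?n \<in> S"
  proof -
    have "M + ?n *\<^sub>R mat 1 \<in> psd_completable E" if "M \<in> locally_psd_tr1 E" for M
    proof -
      have M: "M \<in> locally_psd E" "M \<in> Sym E" "trace M = 1"
        using that by (auto simp: locally_psd_tr1_def locally_psd_def)
      then have "psd (M + ?n *\<^sub>R mat 1)"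
        using locally_psd_entry_le_trace[OF M(1)]
        by (intro psd_add_scaleR_mat_one) (auto simp: Sym_def)
      with Sym_add_scaleR_mat_one[OF M(2)] show ?thesis
        unfolding psd_completable_def by blast
    qed
    then show ?thesis by (simp add: S)
  qed
  ultimately obtain e where e: "e \<in> S" "\<And>t. t \<in> S \<Longrightarrow> e \<le> t"
    using compact_attains_inf[of S] by blast
  \<comment> \<open>Admissible values above the cap lie outside \<open>S\<close>, but exceed
    \<open>e\<close> because \<open>e \<le> ?n\<close>.\<close>
  have "e \<le> t" if "?P t" for t
    using e that S[of t] S[of e] by (cases "t \<le> ?n") auto
  then have "conical_distance E = e"
    unfolding conical_distance_def using e(1) S by (intro Least_equality) blast+
  then show ?thesis using e(1) S by blast
qed

section \<open>Sparsity and the passage between the two problems\<close>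

lemma inner_cong_specified:
  assumes "\<And>i j. \<not> specified E i j \<Longrightarrow> B $ i $ j = 0"
    and "\<And>i j. specified E i j \<Longrightarrow> X $ i $ j = Y $ i $ j"
  shows "B \<bullet> X = (B :: real^'n::finite^'n) \<bullet> Y"
  unfolding inner_vec_def
proof (intro sum.cong refl)
  fix i j
  show "B $ i $ j \<bullet> X $ i $ j = B $ i $ j \<bullet> Y $ i $ j"
    using assms by (cases "specified E i j") auto
qed

lemma trace_cong_specified:
  assumes "\<And>i j. specified E i j \<Longrightarrow> X $ i $ j = Y $ i $ j"
  shows "trace X = trace Y"
  using assms by (simp add: trace_def specified_def)

lemma sparse_data_unspecified:
  assumes "sparse_data E k B" "l \<le> k" "\<not> specified E i j"
  shows "B l $ i $ j = 0"
  using assms by (auto simp: sparse_data_def specified_def)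

lemma psd_scaleR:
  assumes "psd X" "0 \<le> c"
  shows "psd (c *\<^sub>R X)"
proof -
  have "(\<Sum>i\<in>UNIV. \<Sum>j\<in>UNIV. x i * (c *\<^sub>R X) $ i $ j * x j)
      = c * (\<Sum>i\<in>UNIV. \<Sum>j\<in>UNIV. x i * X $ i $ j * x j)" for x
    by (simp add: sum_distrib_left mult_ac)
  with assms show ?thesis by (simp add: psd_on_def)
qed

lemma sdp_feasible_restrict:
  fixes E :: "'n::finite set set"
  assumes "sparse_data E k B" "X \<in> sdp_feasible k B b"
  shows "\<exists>Y \<in> sdp'_feasible E k B b. B 0 \<bullet> Y = B 0 \<bullet> X"
proof -
  define Y where "Y = (\<chi> i j. if specified E i j then X $ i $ j else 0)"
  have X: "psd X" "trace X = 1" "\<forall>l\<in>{1..k}. B l \<bullet> X = b l"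
    using assms(2) by (auto simp: sdp_feasible_def sdp_linear_def)
  have YX: "specified E i j \<Longrightarrow> Y $ i $ j = X $ i $ j" for i j
    by (simp add: Y_def)
  \<comment> \<open>Sparsity hides the unspecified entries from the constraints and, at
    \<open>l = 0\<close>, from the objective.\<close>
  have inner: "B l \<bullet> Y = B l \<bullet> X" if "l \<le> k" for l
    using sparse_data_unspecified[OF assms(1) that] YX by (rule inner_cong_specified)
  have "Y \<in> Sym E"
    using X(1)
    by (auto simp: Sym_def sym_matrix_def transpose_def vec_eq_iff Y_def psd_on_def
        specified_def insert_commute)
  moreover have "psd_on K Y" if "maximal_clique E K" for K
  proof -
    \<comment> \<open>Inside a clique nothing is unspecified, so filling with zeros leaves the
      submatrix of \<open>X\<close> untouched.\<close>
    have "specified E i j" if "i \<in> K" "j \<in> K" for i j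
      using \<open>maximal_clique E K\<close> that by (auto simp: maximal_clique_def clique_def specified_def)
    moreover have "psd_on K X" using X(1) by (rule psd_on_subset) simp
    ultimately show ?thesis by (simp add: psd_on_def YX)
  qed
  ultimately have "Y \<in> locally_psd E" by (simp add: locally_psd_def)
  moreover have "trace Y = trace X" using YX by (rule trace_cong_specified)
  ultimately have "Y \<in> sdp'_feasible E k B b"
    using X inner by (simp add: sdp'_feasible_def sdp_linear_def)
  with inner show ?thesis by blast
qed

text \<open>On specified entries the new point is the convex combination of \<open>Y\<close> and I/n
  with weights 1/(1 + n \<epsilon>) and n \<epsilon>/(1 + n \<epsilon>).\<close>

lemma sdp'_feasible_complete:
  fixes E :: "'n::finite set set"
  defines "n \<equiv> real CARD('n)" and "\<epsilon> \<equiv> conical_distance E"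
  assumes id: "(1 / n) *\<^sub>R mat 1 \<in> sdp_feasible k B b"
    and sparse: "sparse_data E k B"
    and Y: "Y \<in> sdp'_feasible E k B b"
  shows "\<exists>X \<in> sdp_feasible k B b. B 0 \<bullet> X = (B 0 \<bullet> Y + \<epsilon> * trace (B 0)) / (1 + n * \<epsilon>)"
proof -
  have eps: "0 \<le> \<epsilon>"
    using conical_distance_attained[of E] by (simp add: \<epsilon>_def)
  have n: "0 < n" by (simp add: n_def)
  have pos: "0 < 1 + n * \<epsilon>" using eps n by (simp add: add_pos_nonneg)
  have Y': "Y \<in> locally_psd_tr1 E" "trace Y = 1" "\<forall>l\<in>{1..k}. B l \<bullet> Y = b l"
    using Y by (auto simp: sdp'_feasible_def sdp_linear_def locally_psd_tr1_def)
  then have "Y + \<epsilon> *\<^sub>R mat 1 \<in> psd_completable E"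
    using conical_distance_attained[of E] by (simp add: \<epsilon>_def)
  then obtain X where X: "psd X"
      and XY: "\<And>i j. specified E i j \<Longrightarrow> X $ i $ j = (Y + \<epsilon> *\<^sub>R mat 1) $ i $ j"
    unfolding psd_completable_def by blast
  have tr: "trace X = 1 + n * \<epsilon>"
    using trace_cong_specified[of E X "Y + \<epsilon> *\<^sub>R mat 1", OF XY] Y'(2)
    by (simp add: trace_add trace_scaleR trace_mat_one n_def)
  have inner: "B l \<bullet> X = B l \<bullet> Y + \<epsilon> * trace (B l)" if "l \<le> k" for l
    using inner_cong_specified[of E "B l" X "Y + \<epsilon> *\<^sub>R mat 1",
        OF sparse_data_unspecified[OF sparse that] XY]
    by (simp add: inner_add_right inner_mat_one)
  have trB: "trace (B l) = n * b l" if "l \<in> {1..k}" for l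
  proof -
    have "B l \<bullet> ((1 / n) *\<^sub>R mat 1) = b l"
      using id that by (simp add: sdp_feasible_def sdp_linear_def)
    then show ?thesis using n by (simp add: inner_mat_one field_simps)
  qed
  let ?X = "(1 / (1 + n * \<epsilon>)) *\<^sub>R X"
  have "psd ?X" using X pos by (intro psd_scaleR) auto
  moreover have "trace ?X = 1" using tr pos by (simp add: trace_scaleR)
  \<comment> \<open>By \<open>trB\<close> the value at \<open>X\<close> is
    \<open>b l + \<epsilon> * (n * b l)\<close>, a multiple of \<open>b l\<close> by the same factor
    as the trace.\<close>
  moreover have "B l \<bullet> ?X = b l" if "l \<in> {1..k}" for l
    using that Y'(3) inner[of l] trB[OF that] pos by (simp add: field_simps)
  ultimately have "?X \<in> sdp_feasible k B b"
    by (simp add: sdp_feasible_def sdp_linear_def)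
  moreover have "B 0 \<bullet> ?X = (B 0 \<bullet> Y + \<epsilon> * trace (B 0)) / (1 + n * \<epsilon>)"
    using inner[of 0] by simp
  ultimately show ?thesis by blast
qed

section \<open>Comparison of the values in the extended reals\<close>

theorem theorem26:
  fixes E :: "'n::finite set set"
    and k :: nat
    and B :: "nat \<Rightarrow> real^'n^'n"
    and b :: "nat \<Rightarrow> real"
  defines "n \<equiv> real CARD('n)"
    and "\<epsilon> \<equiv> conical_distance E"
    and "\<alpha> \<equiv> sdp_value k B b"
    and "\<alpha>' \<equiv> sdp'_value E k B b"
  assumes "simple_graph E"
    and "\<forall>l \<in> {0..k}. sym_matrix (B l)"
    and "(1 / n) *\<^sub>R mat 1 \<in> sdp_feasible k B b"
    and "sparse_data E k B"
  shows "\<alpha>' \<le> \<alpha> \<and>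
         \<alpha> \<le> ereal (1 / (1 + n * \<epsilon>)) * \<alpha>' + ereal (\<epsilon> / (1 + n * \<epsilon>) * trace (B 0))"
proof
  show le: "\<alpha>' \<le> \<alpha>"
    unfolding \<alpha>_def \<alpha>'_def sdp_value_def sdp'_value_def
  proof (rule INF_mono)
    fix X assume "X \<in> sdp_feasible k B b"
    with assms(8) obtain Y where "Y \<in> sdp'_feasible E k B b" "B 0 \<bullet> Y = B 0 \<bullet> X"
      by (blast dest: sdp_feasible_restrict)
    then show "\<exists>Y\<in>sdp'_feasible E k B b. ereal (B 0 \<bullet> Y) \<le> ereal (B 0 \<bullet> X)"
      by (intro bexI[of _ Y]) simp_all
  qed
  have pos: "0 < 1 + n * \<epsilon>"
    using conical_distance_attained[of E] by (simp add: n_def \<epsilon>_def add_pos_nonneg)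
  \<comment> \<open>The scaled identity rules out the value \<infinity>; at -\<infinity> the second
    inequality is trivial.\<close>
  have "\<alpha> \<le> ereal (B 0 \<bullet> ((1 / n) *\<^sub>R mat 1))"
    unfolding \<alpha>_def sdp_value_def using assms(7) by (rule INF_lower)
  then consider "\<alpha> = -\<infinity>" | a where "\<alpha> = ereal a" by (cases \<alpha>) auto
  then show "\<alpha> \<le> ereal (1 / (1 + n * \<epsilon>)) * \<alpha>' + ereal (\<epsilon> / (1 + n * \<epsilon>) * trace (B 0))"
  proof cases
    case (2 a)
    \<comment> \<open>The claimed bound solved for \<alpha>'. It is checked at each feasible
      \<open>Y\<close> in real arithmetic, so no factor has to be moved through an infimum.\<close>
    define a' where "a' = a * (1 + n * \<epsilon>) - \<epsilon> * trace (B 0)"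
    have "ereal a' \<le> \<alpha>'"
      unfolding \<alpha>'_def sdp'_value_def
    proof (rule INF_greatest)
      fix Y assume "Y \<in> sdp'_feasible E k B b"
      from sdp'_feasible_complete[OF assms(7)[unfolded n_def] assms(8) this]
      obtain X where "X \<in> sdp_feasible k B b"
          and X: "B 0 \<bullet> X = (B 0 \<bullet> Y + \<epsilon> * trace (B 0)) / (1 + n * \<epsilon>)"
        unfolding n_def \<epsilon>_def by blast
      then have "\<alpha> \<le> ereal (B 0 \<bullet> X)"
        unfolding \<alpha>_def sdp_value_def by (intro INF_lower)
      then have "a \<le> (B 0 \<bullet> Y + \<epsilon> * trace (B 0)) / (1 + n * \<epsilon>)" using X 2 by simp
      then show "ereal a' \<le> ereal (B 0 \<bullet> Y)"
        using pos by (simp add: a'_def pos_le_divide_eq)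
    qed
    \<comment> \<open>Lying between \<open>a'\<close> and \<open>a\<close>, the value \<alpha>' is
      finite.\<close>
    with le 2 obtain c where c: "\<alpha>' = ereal c" "a' \<le> c" by (cases \<alpha>') auto
    have "a = (a' + \<epsilon> * trace (B 0)) / (1 + n * \<epsilon>)"
      using pos by (simp add: a'_def)
    also have "\<dots> \<le> (c + \<epsilon> * trace (B 0)) / (1 + n * \<epsilon>)"
      using c pos by (intro divide_right_mono) auto
    finally show ?thesis
      using c 2 by (simp add: add_divide_distrib)
  qed simp
qed

end
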